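(* Let $G$ be a topological rough group with rough identity element $e$ such that $G$ (with the topology $\tau_G$) is Hausdorff and extremally disconnected. If $G$ is open in $\overline{G}$ and $e\in G$, then there exists an open and closed Abelian neighborhood $O$ of $e$ in $G$ (i.e. $ab=ba$ for all $a,b\in O$) such that $a^2=e$ for each $a\in O$.
   Context: An approximation space $(X,R)$ is a non-empty set $X$ with an equivalence relation $R$; for $A\subset X$ the upper approximation is $\overline{A}=\{x\in X:[x]_R\cap A\neq\emptyset\}$, where $[x]_R$ is the equivalence class of $x$. Let $X$ carry a binary operation, written $xy$. A subset $G\subset X$ is a rough group if: (1) $xy\in\overline{G}$ for all $x,y\in G$; (2) $(xy)z=x(yz)$ for all $x,y,z\in\overline{G}$; (3) there is $e\in\overline{G}$ (the rough identity element) with $ex=xe=x$ for all $x\in\overline{G}$; (4) for every $x\in G$ there is $y\in G$ with $xy=yx=e$ (written $y=x^{-1}$). A topological rough group is a rough group $G$ together with a topology $\tau$ on $\overline{G}$ such that, with $\tau_G$ the subspace topology on $G$, the multiplication $G\times G\to\overline{G}$, $(x,y)\mapsto xy$, is continuous (product topology of $\tau_G$ on $G\times G$, $\tau$ on $\overline{G}$) and the inverse mapping $G\to G$, $x\mapsto x^{-1}$, is continuous for $\tau_G$. A space is extremally disconnected if the closure of every open subset is open. *)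

theory Defs
  imports "HOL-Analysis.Analysis"
begin

locale approximation_space =
  fixes X :: "'a set" and R :: "('a \<times> 'a) set"
  assumes nonempty: "X \<noteq> {}"
    and equiv_rel: "equiv X R"
begin

definition upper_approx :: "'a set \<Rightarrow> 'a set" where
  "upper_approx A = {x \<in> X. R `` {x} \<inter> A \<noteq> {}}"

lemma subset_upper_approx:
  assumes "A \<subseteq> X" shows "A \<subseteq> upper_approx A"
  using assms equiv_rel by (auto simp: upper_approx_def dest: equiv_class_self)

end

text \<open>
  The identity element is a parameter of the locale. It is determined by the other
  parameters, since the law \<open>identity\<close> has at most one solution in the upper approximation.
\<close>

locale rough_group = approximation_space X R
  for X :: "'a set" and R :: "('a \<times> 'a) set" +
  fixes mult :: "'a \<Rightarrow> 'a \<Rightarrow> 'a" (infixl "\<cdot>" 70)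
    and G :: "'a set" and e :: 'a
  assumes mult_closed: "\<And>x y. x \<in> X \<Longrightarrow> y \<in> X \<Longrightarrow> x \<cdot> y \<in> X"
    and subset: "G \<subseteq> X"
    and mult_upper: "\<And>x y. x \<in> G \<Longrightarrow> y \<in> G \<Longrightarrow> x \<cdot> y \<in> upper_approx G"
    and assoc: "\<And>x y z. x \<in> upper_approx G \<Longrightarrow> y \<in> upper_approx G \<Longrightarrow> z \<in> upper_approx G
                  \<Longrightarrow> (x \<cdot> y) \<cdot> z = x \<cdot> (y \<cdot> z)"
    and identity_upper: "e \<in> upper_approx G"
    and identity: "\<And>x. x \<in> upper_approx G \<Longrightarrow> e \<cdot> x = x \<and> x \<cdot> e = x"
    and inverse_ex: "\<And>x. x \<in> G \<Longrightarrow> \<exists>y\<in>G. x \<cdot> y = e \<and> y \<cdot> x = e"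
begin

definition rough_inverse :: "'a \<Rightarrow> 'a" where
  "rough_inverse x = (THE y. y \<in> G \<and> x \<cdot> y = e \<and> y \<cdot> x = e)"

lemma rough_inverse_ex1:
  assumes "x \<in> G" shows "\<exists>!y. y \<in> G \<and> x \<cdot> y = e \<and> y \<cdot> x = e"
proof (rule ex_ex1I)
  show "\<exists>y. y \<in> G \<and> x \<cdot> y = e \<and> y \<cdot> x = e"
    using inverse_ex[OF assms] by blast
next
  fix y z
  assume y: "y \<in> G \<and> x \<cdot> y = e \<and> y \<cdot> x = e" and z: "z \<in> G \<and> x \<cdot> z = e \<and> z \<cdot> x = e"
  have up: "x \<in> upper_approx G" "y \<in> upper_approx G" "z \<in> upper_approx G"
    using assms y z subset_upper_approx[OF subset] by auto
  have "y = y \<cdot> (x \<cdot> z)" using y z identity up by metis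
  also have "\<dots> = (y \<cdot> x) \<cdot> z" using assoc up by metis
  also have "\<dots> = z" using y identity up by metis
  finally show "y = z" .
qed

lemma rough_inverse:
  assumes "x \<in> G"
  shows "rough_inverse x \<in> G" "x \<cdot> rough_inverse x = e" "rough_inverse x \<cdot> x = e"
  using theI'[OF rough_inverse_ex1[OF assms]] by (auto simp: rough_inverse_def)

end

locale topological_rough_group = rough_group X R mult G e
  for X :: "'a set" and R :: "('a \<times> 'a) set"
    and mult :: "'a \<Rightarrow> 'a \<Rightarrow> 'a" (infixl "\<cdot>" 70)
    and G :: "'a set" and e :: 'a +
  fixes T :: "'a topology"
  assumes topspace: "topspace T = upper_approx G"
    and continuous_mult:
      "continuous_map (prod_topology (subtopology T G) (subtopology T G)) T (\<lambda>(x, y). x \<cdot> y)"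
    and continuous_inverse:
      "continuous_map (subtopology T G) (subtopology T G) rough_inverse"

definition extremally_disconnected_space :: "'a topology \<Rightarrow> bool" where
  "extremally_disconnected_space T \<longleftrightarrow> (\<forall>U. openin T U \<longrightarrow> openin T (T closure_of U))"

end

theory Submission
  imports Defs
begin

text \<open>
  In an extremally disconnected Hausdorff space the fixed-point set of a continuous involution
  \<open>f\<close> is open: an open set \<open>M\<close> maximal among those disjoint from their image is clopen, and a
  non-fixed point outside \<open>M \<union> f\<^sup>-\<^sup>1 M\<close> would allow \<open>M\<close> to be enlarged. Applied to the
  inversion, this shows that the set \<open>F\<close> of solutions of \<open>x\<^sup>2 = e\<close> in \<open>G\<close> is open. Elements of a
  neighbourhood \<open>W\<close> of \<open>e\<close> with \<open>W W \<subseteq> F\<close> commute, since \<open>a b\<close> and \<open>b a\<close> are then mutually inverse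
  involutions. Finally, if \<open>V V \<subseteq> W\<close> with \<open>V\<close> open, then the closure of \<open>V\<close> in \<open>G\<close>, which is
  clopen, still lies in \<open>V V\<^sup>-\<^sup>1 = V V \<subseteq> W\<close>.
\<close>

text \<open>An open set disjoint from \<open>U\<close> misses its closure. This is used twice: for
  the preimage of \<open>U\<close>, and for the preimage of the closure, which is open by extremal
  disconnectedness.\<close>

lemma extremally_disconnected_moved_closure:
  assumes ed: "extremally_disconnected_space T"
    and f: "continuous_map T T f"
    and inv: "\<And>x. x \<in> topspace T \<Longrightarrow> f (f x) = x"
    and U: "openin T U" "\<And>x. x \<in> U \<Longrightarrow> f x \<notin> U"
    and x: "x \<in> T closure_of U"
  shows "f x \<notin> T closure_of U"
proof -
  let ?N = "{x \<in> topspace T. f x \<in> T closure_of U}"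
  have "openin T {x \<in> topspace T. f x \<in> U}"
    using f U(1) by (rule openin_continuous_map_preimage)
  moreover have "{x \<in> topspace T. f x \<in> U} \<inter> U = {}"
    using U(2) by auto
  ultimately have "{x \<in> topspace T. f x \<in> U} \<inter> T closure_of U = {}"
    by (simp add: openin_Int_closure_of_eq_empty)
  \<comment> \<open>If \<open>y\<close> in \<open>U\<close> had \<open>f y\<close> in the closure,
    then \<open>f (f y) = y\<close> would put \<open>f y\<close> into the preimage of
    \<open>U\<close> as well.\<close>
  then have "?N \<inter> U = {}"
    using inv continuous_map_image_subset_topspace[OF f] openin_subset[OF U(1)] by fastforce
  moreover have "openin T ?N"
    using f ed U(1) by (intro openin_continuous_map_preimage)
      (auto simp: extremally_disconnected_space_def)
  ultimately have "?N \<inter> T closure_of U = {}"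
    by (simp add: openin_Int_closure_of_eq_empty)
  moreover have "x \<in> topspace T"
    using x by (simp add: in_closure_of)
  ultimately show ?thesis
    using x by blast
qed

lemma openin_fixed_points_involution:
  assumes ed: "extremally_disconnected_space T"
    and haus: "Hausdorff_space T"
    and f: "continuous_map T T f"
    and inv: "\<And>x. x \<in> topspace T \<Longrightarrow> f (f x) = x"
  shows "openin T {x \<in> topspace T. f x = x}"
proof -
  let ?P = "{U. openin T U \<and> (\<forall>x\<in>U. f x \<notin> U)}"
  have "\<exists>U\<in>?P. \<forall>A\<in>\<C>. A \<subseteq> U" if "subset.chain ?P \<C>" for \<C>
  proof (intro bexI[where x = "\<Union>\<C>"] ballI Union_upper CollectI conjI)
    show "openin T (\<Union>\<C>)"
      using that by (auto simp: subset.chain_def)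
    show "f x \<notin> \<Union>\<C>" if x: "x \<in> \<Union>\<C>" for x
    proof
      assume "f x \<in> \<Union>\<C>"
      then obtain A B where "A \<in> \<C>" "B \<in> \<C>" "x \<in> A" "f x \<in> B"
        using x by blast
      \<comment> \<open>\<open>A\<close> and \<open>B\<close> are comparable, so the larger one
        contains both \<open>x\<close> and \<open>f x\<close>.\<close>
      then show False
        using \<open>subset.chain ?P \<C>\<close> unfolding subset_chain_def by blast
    qed
  qed
  from subset_Zorn[OF this] obtain M where M: "openin T M" "\<And>x. x \<in> M \<Longrightarrow> f x \<notin> M"
    and max: "\<And>U. openin T U \<Longrightarrow> (\<And>x. x \<in> U \<Longrightarrow> f x \<notin> U) \<Longrightarrow> M \<subseteq> U \<Longrightarrow> U = M"
    by auto
  \<comment> \<open>The closure of \<open>M\<close> is open and still disjoint from its image, so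
    maximality makes \<open>M\<close> closed.\<close>
  have "T closure_of M = M"
  proof (rule max)
    show "openin T (T closure_of M)"
      using ed M(1) by (simp add: extremally_disconnected_space_def)
    show "M \<subseteq> T closure_of M"
      by (simp add: M(1) closure_of_subset openin_subset)
  qed (rule extremally_disconnected_moved_closure[OF ed f inv M])
  then have clM: "closedin T M"
    by (metis closedin_closure_of)
  \<comment> \<open>\<open>Y\<close> turns out to be exactly the fixed-point set.\<close>
  define Y where "Y = topspace T - (M \<union> {x \<in> topspace T. f x \<in> M})"
  have opY: "openin T Y"
    unfolding Y_def using clM f
    by (intro openin_diff openin_topspace closedin_Un closedin_continuous_map_preimage)
  have Y_inv: "f x \<in> Y" if "x \<in> Y" for x
    using that inv continuous_map_image_subset_topspace[OF f] by (auto simp: Y_def)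
  have "f x = x" if x: "x \<in> Y" for x
  proof (rule ccontr)
    assume "f x \<noteq> x"
    then obtain A B where AB: "openin T A" "openin T B" "x \<in> A" "f x \<in> B" "disjnt A B"
      using haus x Y_inv[OF x] unfolding Hausdorff_space_def Y_def by (metis DiffD1)
    \<comment> \<open>\<open>V\<close> lies in \<open>A\<close> and its image in \<open>B\<close>,
      so \<open>V\<close> misses its image; inside \<open>Y\<close>, it also does not interact with
      \<open>M\<close>.\<close>
    define V where "V = Y \<inter> A \<inter> {x \<in> topspace T. f x \<in> B}"
    have "openin T V"
      unfolding V_def using opY AB f by (intro openin_Int openin_continuous_map_preimage)
    have "M \<union> V = M"
    proof (rule max)
      show "openin T (M \<union> V)"
        using M(1) \<open>openin T V\<close> by blast
      show "f y \<notin> M \<union> V" if "y \<in> M \<union> V" for y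
      proof (cases "y \<in> M")
        case True
        then have "y \<notin> Y" "y \<in> topspace T"
          using openin_subset[OF M(1)] by (auto simp: Y_def)
        then have "f y \<notin> Y"
          using Y_inv inv by metis
        then show ?thesis
          using M(2) True by (auto simp: V_def)
      next
        case False
        then have "y \<in> V"
          using that by blast
        then show ?thesis
          using AB(5) by (auto simp: V_def Y_def disjnt_iff)
      qed
    qed auto
    moreover have "x \<in> V"
      using x AB by (auto simp: V_def Y_def)
    ultimately show False
      using x by (auto simp: Y_def)
  qed
  moreover have "x \<in> Y" if "x \<in> topspace T" "f x = x" for x
    using that M(2)[of x] by (auto simp: Y_def)
  moreover have "Y \<subseteq> topspace T"
    by (auto simp: Y_def)
  ultimately have "{x \<in> topspace T. f x = x} = Y"
    by blast
  then show ?thesis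
    using opY by simp
qed

context rough_group
begin

lemma in_upper: "x \<in> G \<Longrightarrow> x \<in> upper_approx G"
  using subset_upper_approx[OF subset] by blast

lemma rough_inverse_unique:
  assumes "x \<in> G" "y \<in> G" "x \<cdot> y = e" "y \<cdot> x = e"
  shows "rough_inverse x = y"
  using assms rough_inverse rough_inverse_ex1 by blast

lemma rough_inverse_inverse: "x \<in> G \<Longrightarrow> rough_inverse (rough_inverse x) = x"
  by (simp add: rough_inverse rough_inverse_unique)

lemma rough_inverse_fixed_iff: "x \<in> G \<Longrightarrow> rough_inverse x = x \<longleftrightarrow> x \<cdot> x = e"
  using rough_inverse rough_inverse_unique by metis

lemma involutions_commute:
  assumes "a \<in> G" "b \<in> G" "a \<cdot> b \<in> G" "b \<cdot> a \<in> G"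
    and "a \<cdot> a = e" "b \<cdot> b = e" "(b \<cdot> a) \<cdot> (b \<cdot> a) = e"
  shows "a \<cdot> b = b \<cdot> a"
proof -
  have *: "(x \<cdot> y) \<cdot> (y \<cdot> x) = e"
    if "x \<in> G" "y \<in> G" "y \<cdot> x \<in> G" "x \<cdot> x = e" "y \<cdot> y = e" for x y
  proof -
    have "(x \<cdot> y) \<cdot> (y \<cdot> x) = x \<cdot> (y \<cdot> (y \<cdot> x))"
      using that by (simp add: assoc in_upper)
    also have "y \<cdot> (y \<cdot> x) = (y \<cdot> y) \<cdot> x"
      using that by (metis assoc in_upper)
    finally show ?thesis
      using that by (simp add: identity in_upper)
  qed
  \<comment> \<open>Both \<open>a \<cdot> b\<close> and \<open>b \<cdot> a\<close> itself are
    inverse to \<open>b \<cdot> a\<close>, and inverses in \<open>G\<close> are unique.\<close>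
  have "rough_inverse (b \<cdot> a) = a \<cdot> b"
    using assms by (intro rough_inverse_unique *)
  moreover have "rough_inverse (b \<cdot> a) = b \<cdot> a"
    using assms by (intro rough_inverse_unique)
  ultimately show ?thesis
    by simp
qed

end

context topological_rough_group
begin

lemma topspace_subtopology_G: "topspace (subtopology T G) = G"
  using topspace in_upper by auto

lemma openin_left_translation:
  assumes "a \<in> G" "openin T U"
  shows "openin (subtopology T G) {y \<in> G. a \<cdot> y \<in> U}"
proof -
  let ?S = "subtopology T G"
  have "continuous_map ?S (prod_topology ?S ?S) (\<lambda>y. (a, y))"
    using assms(1) by (intro continuous_map_pairedI)
      (auto simp: topspace_subtopology_G simp del: topspace_subtopology)
  from continuous_map_compose[OF this continuous_mult]
  have "continuous_map ?S T (\<lambda>y. a \<cdot> y)"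
    by (simp add: o_def)
  from openin_continuous_map_preimage[OF this assms(2)] show ?thesis
    by (simp only: topspace_subtopology_G)
qed

text \<open>Continuity of multiplication at \<open>(e, e)\<close> gives a box
  \<open>A \<times> B\<close>; the intersection \<open>A \<inter> B\<close> serves for both
  factors.\<close>

lemma square_neighbourhood:
  assumes "e \<in> G" "openin T U" "e \<in> U"
  obtains V where "openin (subtopology T G) V" "e \<in> V"
    "\<And>a b. a \<in> V \<Longrightarrow> b \<in> V \<Longrightarrow> a \<cdot> b \<in> U"
proof -
  let ?S = "subtopology T G"
  let ?D = "{p \<in> topspace (prod_topology ?S ?S). (\<lambda>(x, y). x \<cdot> y) p \<in> U}"
  have "openin (prod_topology ?S ?S) ?D"
    using continuous_mult assms(2) by (rule openin_continuous_map_preimage)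
  moreover have "(e, e) \<in> ?D"
    using assms identity[OF identity_upper]
    by (auto simp: topspace_subtopology_G simp del: topspace_subtopology)
  ultimately obtain A B where AB: "openin ?S A" "openin ?S B" "e \<in> A" "e \<in> B" "A \<times> B \<subseteq> ?D"
    unfolding openin_prod_topology_alt by meson
  show thesis
  proof
    show "openin ?S (A \<inter> B)" "e \<in> A \<inter> B"
      using AB by auto
    show "a \<cdot> b \<in> U" if "a \<in> A \<inter> B" "b \<in> A \<inter> B" for a b
      using that AB(5) by fastforce
  qed
qed

text \<open>
  The usual proof that topological groups are regular; the translates \<open>x V\<close> need not stay
  inside \<open>G\<close>, hence the preimages under left translation by \<open>x\<^sup>-\<^sup>1\<close>.
\<close>

lemma closure_of_subset_square:
  assumes V: "openin T V" "V \<subseteq> G" "e \<in> V" "\<And>v. v \<in> V \<Longrightarrow> v \<cdot> v = e"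
    and x: "x \<in> subtopology T G closure_of V"
  obtains y v where "y \<in> V" "v \<in> V" "x = y \<cdot> v"
proof -
  have xG: "x \<in> G"
    using x by (auto simp: in_closure_of)
  let ?i = "rough_inverse x"
  have "openin (subtopology T G) {y \<in> G. ?i \<cdot> y \<in> V}"
    using rough_inverse(1)[OF xG] V(1) by (rule openin_left_translation)
  moreover have "x \<in> {y \<in> G. ?i \<cdot> y \<in> V}"
    using xG rough_inverse V(3) by simp
  \<comment> \<open>This preimage is an open neighbourhood of \<open>x\<close>, hence meets
    \<open>V\<close>.\<close>
  ultimately obtain y where y: "y \<in> V" "?i \<cdot> y \<in> V"
    using x by (metis (mono_tags, lifting) in_closure_of mem_Collect_eq)
  let ?v = "?i \<cdot> y"
  have up: "x \<in> upper_approx G" "?i \<in> upper_approx G" "y \<in> upper_approx G" "?v \<in> upper_approx G"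
    using xG rough_inverse(1)[OF xG] y V(2) in_upper by auto
  have "y = x \<cdot> ?v"
    using assoc[of x ?i y] up identity rough_inverse(2)[OF xG] by simp
  \<comment> \<open>As \<open>?v\<close> is its own inverse, \<open>y = x \<cdot> ?v\<close> can be
    solved for \<open>x\<close> without leaving \<open>V\<close>.\<close>
  then have "y \<cdot> ?v = x \<cdot> (?v \<cdot> ?v)"
    using assoc[of x ?v ?v] up by simp
  then have "x = y \<cdot> ?v"
    using V(4)[OF y(2)] identity up by simp
  then show thesis
    using that y by blast
qed

end

theorem theorem4p16:
  fixes X :: "'a set" and R :: "('a \<times> 'a) set" and mult :: "'a \<Rightarrow> 'a \<Rightarrow> 'a"
    and G :: "'a set" and e :: 'a and T :: "'a topology"
  assumes "topological_rough_group X R mult G e T"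
    and "Hausdorff_space (subtopology T G)"
    and "extremally_disconnected_space (subtopology T G)"
    and "openin T G"
    and "e \<in> G"
  shows "\<exists>U. openin (subtopology T G) U \<and> closedin (subtopology T G) U \<and> e \<in> U \<and>
             (\<forall>a\<in>U. \<forall>b\<in>U. mult a b = mult b a) \<and>
             (\<forall>a\<in>U. mult a a = e)"
proof -
  interpret topological_rough_group X R mult G e T
    by fact
  let ?S = "subtopology T G"
  let ?F = "{x \<in> G. mult x x = e}"
  have ee: "mult e e = e"
    using identity[OF identity_upper] by simp
  \<comment> \<open>Openness of \<open>G\<close> lets sets open in \<open>G\<close> serve as targets
    in \<open>square_neighbourhood\<close>, which asks for openness in \<open>T\<close>.\<close>
  have open_iff: "openin ?S U \<longleftrightarrow> openin T U \<and> U \<subseteq> G" for U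
    using assms(4) by (rule openin_open_subtopology)
  have "openin ?S {x \<in> topspace ?S. rough_inverse x = x}"
    using assms continuous_inverse
    by (intro openin_fixed_points_involution)
      (auto simp: topspace_subtopology_G rough_inverse_inverse)
  also have "{x \<in> topspace ?S. rough_inverse x = x} = ?F"
    using rough_inverse_fixed_iff by (auto simp only: topspace_subtopology_G)
  finally have "openin T ?F"
    by (simp add: open_iff)
  then obtain W where W: "openin ?S W" "e \<in> W" "\<And>a b. a \<in> W \<Longrightarrow> b \<in> W \<Longrightarrow> mult a b \<in> ?F"
    using square_neighbourhood[of ?F] assms(5) ee by blast
  \<comment> \<open>Write \<open>a\<close> as \<open>a\<close> times \<open>e\<close>, a product of
    two elements of \<open>W\<close>.\<close>
  have W_F: "a \<in> ?F" if "a \<in> W" for a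
  proof -
    have "a \<in> upper_approx G"
      using that W(1) open_iff in_upper by blast
    then show ?thesis
      using W(3)[OF that W(2)] identity by simp
  qed
  from W(1) have "openin T W"
    by (simp add: open_iff)
  then obtain V where V: "openin ?S V" "e \<in> V" "\<And>a b. a \<in> V \<Longrightarrow> b \<in> V \<Longrightarrow> mult a b \<in> W"
    using square_neighbourhood[of W] assms(5) W(2) by blast
  have V_W: "a \<in> W" if "a \<in> V" for a
  proof -
    have "a \<in> upper_approx G"
      using that V(1) open_iff in_upper by blast
    then show ?thesis
      using V(3)[OF that V(2)] identity by simp
  qed
  let ?O = "?S closure_of V"
  have O_W: "x \<in> W" if "x \<in> ?O" for x
  proof (rule closure_of_subset_square[OF _ _ V(2) _ that])
    show "openin T V" "V \<subseteq> G"
      using V(1) by (simp_all add: open_iff)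
    show "mult v v = e" if "v \<in> V" for v
      using W_F[OF V_W[OF that]] by simp
  qed (use V(3) in simp)
  show ?thesis
  proof (intro exI[of _ ?O] conjI ballI)
    show "openin ?S ?O"
      using assms(3) V(1) by (simp add: extremally_disconnected_space_def)
    show "closedin ?S ?O"
      by simp
    show "e \<in> ?O"
      using closure_of_subset[OF openin_subset[OF V(1)]] V(2) by blast
    show "mult a a = e" if "a \<in> ?O" for a
      using W_F[OF O_W[OF that]] by simp
    \<comment> \<open>\<open>W(3)\<close> puts both products into \<open>?F\<close>, so they lie in
      \<open>G\<close> and square to \<open>e\<close>.\<close>
    show "mult a b = mult b a" if "a \<in> ?O" "b \<in> ?O" for a b
      using W_F[OF O_W[OF that(1)]] W_F[OF O_W[OF that(2)]]
        W(3)[OF O_W[OF that(1)] O_W[OF that(2)]] W(3)[OF O_W[OF that(2)] O_W[OF that(1)]]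
      by (intro involutions_commute) auto
  qed
qed

end
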